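(* With $g(n)$ denoting the least possible value of $x_n$ among all solutions in positive integers $1\le x_1\le x_2\le\dots\le x_n$ of the equation $n(x_1+x_2+\dots+x_n)=x_1x_2\cdots x_n$, one has $$\liminf_{n\to\infty}\frac{g(n)}{\sqrt[3]{n}}\le 1.$$
   Context: For a positive integer $n$, Erdős's last equation is the Diophantine equation $$n(x_1+x_2+\dots+x_n)=x_1x_2\cdots x_n,\qquad 1\le x_1\le x_2\le\dots\le x_n,$$ in positive integers $x_1,\dots,x_n$. For every $n$ at least one solution exists, so that $g(n)$, the minimum of the largest entry $x_n$ over all solutions $(x_1,\dots,x_n)$ for the given $n$, is well defined. *)

theory Defs
  imports "HOL-Analysis.Analysis"
begin

(* Only the values of x on {1..n} matter. *)
definition erdos_last_solution :: "nat \<Rightarrow> (nat \<Rightarrow> nat) \<Rightarrow> bool" where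
  "erdos_last_solution n x \<longleftrightarrow>
     (\<forall>i\<in>{1..n}. 1 \<le> x i) \<and> mono_on {1..n} x \<and>
     n * (\<Sum>i=1..n. x i) = (\<Prod>i=1..n. x i)"

definition g :: "nat \<Rightarrow> nat" where
  "g n = (LEAST m. \<exists>x. erdos_last_solution n x \<and> x n = m)"

(* The set minimised over in g is nonempty for every positive n; g 0 is a junk value. *)
lemma erdos_last_solution_exists:
  assumes "1 \<le> n"
  shows "\<exists>x. erdos_last_solution n x"
proof -
  consider "n = 1" | "n = 2" | m where "n = Suc (Suc (Suc m))"
    using assms by (metis One_nat_def Suc_1 not0_implies_Suc not_one_le_zero)
  then show ?thesis
  proof cases
    case 1
    then have "erdos_last_solution n (\<lambda>_. 1)"
      by (simp add: erdos_last_solution_def mono_on_def)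
    then show ?thesis by blast
  next
    case 2
    then have "erdos_last_solution n (\<lambda>_. 4)"
      by (simp add: erdos_last_solution_def mono_on_def)
    then show ?thesis by blast
  next
    case (3 m)
    define x :: "nat \<Rightarrow> nat" where
      "x i = (if i \<le> m then 1 else if i = Suc m then 2 else if i = Suc (Suc m) then n
              else 2 * n - 1)" for i
    have s: "(\<Sum>i=1..m. x i) = m" and p: "(\<Prod>i=1..m. x i) = 1"
      by (simp_all add: x_def)
    have "(\<Sum>i=1..n. x i) = m + 2 + n + (2 * n - 1)"
      using s by (simp add: 3 x_def)
    moreover have "(\<Prod>i=1..n. x i) = 2 * n * (2 * n - 1)"
      using p by (simp add: 3 x_def)
    ultimately have "n * (\<Sum>i=1..n. x i) = (\<Prod>i=1..n. x i)"
      by (simp add: 3 algebra_simps)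
    then have "erdos_last_solution n x"
      by (auto simp: erdos_last_solution_def mono_on_def x_def 3)
    then show ?thesis by blast
  qed
qed

end

theory Submission
  imports Defs
begin

text \<open>
  A solution whose largest entry is about \<open>n\<^sup>1\<^sup>/\<^sup>3\<close> can be built from six entries close to a
  number \<open>m\<close>, all others being \<open>1\<close>: the product then has order \<open>m\<^sup>6\<close> and the sum is close
  to \<open>n\<close>, so \<open>n\<close> must have order \<open>m\<^sup>3\<close>. Let \<open>n\<close> be the product of three of the six entries;
  the equation then says that the product of the other three equals the sum of all entries, that is,
  \<open>n - 6\<close> plus the sum of the six. If both triples consist of \<open>m\<close> plus offsets with sum zero,
  then comparing coefficients of \<open>m\<close> asks for two triples of offsets whose second elementary
  symmetric functions differ by \<open>6\<close> and whose products differ by \<open>-6\<close>. The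
  offsets \<open>(-1, 0, 1)\<close> and \<open>(-2, -1, 3)\<close> have these properties, which amounts to the identity
  \<open>(m - 1) m (m + 1) = (m - 2) (m - 1) (m + 3) - 6 + 6 m\<close>.

  Hence \<open>n = (m - 2) (m - 1) (m + 3)\<close> satisfies \<open>g n \<le> m + 3\<close>, and along these \<open>n\<close>
  the quotient is at most \<open>(m + 3) / (m - 2)\<close>, which tends to \<open>1\<close>. Below, \<open>m = k + 3\<close>
  with \<open>k\<close> a natural number, which avoids truncated subtraction.
\<close>

lemma g_le_last_entry:
  assumes "erdos_last_solution n x"
  shows "g n \<le> x n"
  unfolding g_def using assms by (intro Least_le) blast

text \<open>
  Of the six large entries, \<open>k + 1\<close>, \<open>k + 2\<close> and \<open>k + 6\<close> multiply to \<open>n\<close>; the others,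
  \<open>k + 2\<close>, \<open>k + 3\<close> and \<open>k + 4\<close>, multiply to the sum of all entries.
\<close>

lemma g_cubic_le: "g ((k + 1) * (k + 2) * (k + 6)) \<le> k + 6"
proof -
  \<comment> \<open>\<open>N\<close> is \<open>n - 6\<close>, the number of entries that are put equal to \<open>1\<close>.\<close>
  define N where "N = k ^ 3 + 9 * k\<^sup>2 + 20 * k + 6"
  define n where "n = (k + 1) * (k + 2) * (k + 6)"
  have n: "n = Suc (Suc (Suc (Suc (Suc (Suc N)))))"
    by (simp add: n_def N_def algebra_simps power2_eq_square power3_eq_cube)
  define x where
    "x i = (if i \<le> N then 1 else if i = N + 1 then k + 1 else if i \<le> N + 3 then k + 2
            else if i = N + 4 then k + 3 else if i = N + 5 then k + 4 else k + 6)" for i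
  have ones: "(\<Sum>i=1..N. x i) = N" "(\<Prod>i=1..N. x i) = 1"
    by (simp_all add: x_def)
  have "(\<Sum>i=1..n. x i) = N + (k + 1) + (k + 2) + (k + 2) + (k + 3) + (k + 4) + (k + 6)"
    using ones by (simp add: n x_def)
  also have "\<dots> = (k + 2) * (k + 3) * (k + 4)"
    by (simp add: N_def algebra_simps power2_eq_square power3_eq_cube)
  finally have sum: "(\<Sum>i=1..n. x i) = (k + 2) * (k + 3) * (k + 4)" .
  have "(\<Prod>i=1..n. x i) = (k + 1) * (k + 2) * (k + 2) * (k + 3) * (k + 4) * (k + 6)"
    using ones by (simp add: n x_def)
  also have "\<dots> = n * ((k + 2) * (k + 3) * (k + 4))"
    by (simp only: n_def ac_simps)
  finally have "n * (\<Sum>i=1..n. x i) = (\<Prod>i=1..n. x i)"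
    by (simp only: sum)
  moreover have "mono_on {1..n} x"
    by (auto simp: mono_on_def x_def)
  moreover have "\<forall>i\<in>{1..n}. 1 \<le> x i"
    by (simp add: x_def)
  ultimately have "erdos_last_solution n x"
    by (simp add: erdos_last_solution_def)
  moreover have "x n = k + 6"
    by (simp add: x_def n)
  ultimately show ?thesis
    using g_le_last_entry n_def by metis
qed

theorem theorem1:
  shows "liminf (\<lambda>n. ereal (real (g n) / root 3 (real n))) \<le> 1"
proof -
  define q where "q n = ereal (real (g n) / root 3 (real n))" for n
  define r :: "nat \<Rightarrow> nat" where "r k = (k + 1) * (k + 2) * (k + 6)" for k
  have "strict_mono r"
    by (rule strict_monoI_Suc) (simp add: r_def algebra_simps)
  then have "liminf q \<le> liminf (q \<circ> r)"
    by (rule liminf_subseq_mono)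
  also have "\<dots> \<le> liminf (\<lambda>k. ereal ((real k + 6) / (real k + 1)))"
  proof (intro Liminf_mono always_eventually allI)
    fix k
    have "(k + 1) ^ 3 \<le> r k"
      unfolding r_def power3_eq_cube by (intro mult_mono) auto
    then have "(real k + 1) ^ 3 \<le> real (r k)"
      using of_nat_mono[where 'a = real, of "(k + 1) ^ 3" "r k"] by (simp add: add.commute)
    then have "root 3 ((real k + 1) ^ 3) \<le> root 3 (real (r k))"
      by simp
    then have "real k + 1 \<le> root 3 (real (r k))"
      by (simp add: real_root_power_cancel)
    moreover have "real (g (r k)) \<le> real k + 6"
      using g_cubic_le[of k] by (simp add: r_def flip: of_nat_le_iff)
    ultimately have "real (g (r k)) / root 3 (real (r k)) \<le> (real k + 6) / (real k + 1)"
      by (intro frac_le) auto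
    then show "(q \<circ> r) k \<le> ereal ((real k + 6) / (real k + 1))"
      by (simp add: q_def)
  qed
  also have "\<dots> = 1"
  proof (rule lim_imp_Liminf)
    have "(\<lambda>k. 1 + 5 * inverse (real (Suc k))) \<longlonglongrightarrow> 1 + 5 * 0"
      by (intro tendsto_intros LIMSEQ_inverse_real_of_nat)
    moreover have "1 + 5 * inverse (real (Suc k)) = (real k + 6) / (real k + 1)" for k
      by (simp add: field_simps)
    ultimately have "(\<lambda>k. (real k + 6) / (real k + 1)) \<longlonglongrightarrow> 1"
      by simp
    then show "(\<lambda>k. ereal ((real k + 6) / (real k + 1))) \<longlonglongrightarrow> 1"
      by (simp add: one_ereal_def)
  qed simp
  finally show ?thesis
    by (simp add: q_def[abs_def])
qed

end
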